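(* Let $DOM(G;X)=\sum_{A\subseteq V(G):\,A\text{ is a dominating set of }G}X^{|A|}$. There is no graph property $\mathcal{C}$ such that $DOM(G;X)=\chi_{\mathcal{C}}(G;X)$ for all graphs $G$.
   Context: All graphs are finite without multiple edges. A set $A\subseteq V(G)$ is dominating if every vertex not in $A$ has a neighbor in $A$. A graph property is an isomorphism-closed class of graphs. For a graph property $\mathcal{C}$ and $k\in\mathbb{N}$, $\chi_{\mathcal{C}}(G;k)$ is the number of maps $f:V(G)\to\{1,\dots,k\}$ such that each nonempty color class $f^{-1}(c)$ induces a graph in $\mathcal{C}$; it is known to be a polynomial in $k$, denoted $\chi_{\mathcal{C}}(G;X)$. *)

theory Defs
  imports
    "Graph_Theory.Graph_Theory"
    "HOL-Computational_Algebra.Polynomial"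
    "HOL-Library.FuncSet"
    "HOL-Library.Disjoint_Sets"
begin

text \<open>
  An undirected graph without multiple edges is a symmetric digraph whose arcs are pairs of
  vertices: \<^term>\<open>pair_pseudo_graph G\<close> says that \<open>G\<close> is such a graph, finite and possibly with
  loops; \<^term>\<open>pair_graph G\<close> additionally excludes loops.
  Every finite graph is isomorphic to one on a finite set of natural numbers, so an
  isomorphism-closed class of finite graphs is represented by a set of graphs over \<^typ>\<open>nat\<close>.
\<close>

definition pair_induce :: "'a pair_pre_digraph \<Rightarrow> 'a set \<Rightarrow> 'a pair_pre_digraph" where
  "pair_induce G U = \<lparr>pverts = U, parcs = parcs G \<inter> U \<times> U\<rparr>"

lemma with_proj_pair_induce: "with_proj (pair_induce G U) = with_proj G \<restriction> U"
  by (auto simp: pair_induce_def with_proj_def induce_subgraph_def)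

definition graph_property ::
    "('a pair_pre_digraph \<Rightarrow> bool) \<Rightarrow> 'a pair_pre_digraph set \<Rightarrow> bool" where
  "graph_property is_graph \<C> \<longleftrightarrow>
     (\<forall>G\<in>\<C>. is_graph G) \<and>
     (\<forall>G\<in>\<C>. \<forall>H. is_graph H \<and> digraph_iso (with_proj G) (with_proj H) \<longrightarrow> H \<in> \<C>)"

definition dominating_set :: "'a pair_pre_digraph \<Rightarrow> 'a set \<Rightarrow> bool" where
  "dominating_set G A \<longleftrightarrow>
     A \<subseteq> pverts G \<and> (\<forall>v \<in> pverts G - A. \<exists>u\<in>A. (v, u) \<in> parcs G)"

definition DOM :: "'a pair_pre_digraph \<Rightarrow> int poly" where
  "DOM G = (\<Sum>A | dominating_set G A. monom 1 (card A))"

definition colorings :: "'a pair_pre_digraph set \<Rightarrow> 'a pair_pre_digraph \<Rightarrow> nat \<Rightarrow> ('a \<Rightarrow> nat) set"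
  where
  "colorings \<C> G k = {f \<in> pverts G \<rightarrow>\<^sub>E {1..k}.
     \<forall>c\<in>{1..k}. {v \<in> pverts G. f v = c} \<noteq> {} \<longrightarrow>
       pair_induce G {v \<in> pverts G. f v = c} \<in> \<C>}"

text \<open>The unique polynomial interpolating the number of colorings; see \<open>poly_chi\<close> below.\<close>

definition chi :: "'a pair_pre_digraph set \<Rightarrow> 'a pair_pre_digraph \<Rightarrow> int poly" where
  "chi \<C> G = (THE p. \<forall>k::nat. poly p (int k) = int (card (colorings \<C> G k)))"

lemma card_funcs_with_fibres:
  fixes V :: "'a set" and K :: "'b set"
  assumes V: "finite V" and K: "finite K" and P: "partition_on V P"
  shows "card {f \<in> V \<rightarrow>\<^sub>E K. (\<lambda>c. {v\<in>V. f v = c}) ` (f ` V) = P}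
           = prod ((-) (card K)) {0..<card P}"
proof -
  have finP: "finite P" using finite_elements[OF V P] .
  define blk where "blk v = (THE B. B \<in> P \<and> v \<in> B)" for v
  have blk: "blk v = B" if "B \<in> P" "v \<in> B" for v B
    unfolding blk_def using that P
    by (intro the_equality) (auto simp: partition_on_def disjoint_def)
  have blk_in: "blk v \<in> P" "v \<in> blk v" if "v \<in> V" for v
    using that P blk by (auto simp: partition_on_def)
  have sub: "B \<subseteq> V" if "B \<in> P" for B using that P by (auto simp: partition_on_def)
  have ne: "B \<noteq> {}" if "B \<in> P" for B using that P by (auto simp: partition_on_def)
  have "bij_betw (\<lambda>g. \<lambda>v\<in>V. g (blk v)) {g \<in> P \<rightarrow>\<^sub>E K. inj_on g P}
          {f \<in> V \<rightarrow>\<^sub>E K. (\<lambda>c. {v\<in>V. f v = c}) ` (f ` V) = P}" (is "bij_betw ?F ?A ?B")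
  proof (rule bij_betw_imageI)
    show "inj_on ?F ?A"
    proof (rule inj_onI)
      fix g h assume g: "g \<in> ?A" and h: "h \<in> ?A" and eq: "?F g = ?F h"
      show "g = h"
      proof (rule PiE_ext[of g P "\<lambda>_. K"])
        fix B assume B: "B \<in> P"
        then obtain v where v: "v \<in> B" using ne by blast
        then have "v \<in> V" using sub B by blast
        then show "g B = h B" using fun_cong[OF eq, of v] blk[OF B v] by simp
      qed (use g h in auto)
    qed
    have fib: "{v \<in> V. ?F g v = g B} = B" if g: "g \<in> ?A" and B: "B \<in> P" for g B
    proof -
      have "v \<in> B" if "v \<in> V" "g (blk v) = g B" for v
        using that g B blk_in[of v] by (auto dest: inj_onD)
      then show ?thesis using sub[OF B] blk[OF B] by auto
    qed
    have img: "?F g ` V = g ` P" for g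
    proof -
      have "blk ` V = P"
      proof
        show "blk ` V \<subseteq> P" using blk_in by blast
        show "P \<subseteq> blk ` V"
        proof
          fix B assume B: "B \<in> P"
          then obtain v where v: "v \<in> B" using ne by blast
          then show "B \<in> blk ` V" using blk[OF B v] sub[OF B] by blast
        qed
      qed
      then show ?thesis by force
    qed
    show "?F ` ?A = ?B"
    proof (intro equalityI subsetI)
      fix f assume "f \<in> ?F ` ?A"
      then obtain g where g: "g \<in> ?A" and f: "f = ?F g" by blast
      have "(\<lambda>c. {v\<in>V. f v = c}) ` (f ` V) = (\<lambda>B. {v\<in>V. f v = g B}) ` P"
        unfolding f img by (simp only: image_image)
      also have "\<dots> = (\<lambda>B. B) ` P"
        unfolding f by (rule image_cong[OF refl], rule fib[OF g])
      finally have "(\<lambda>c. {v\<in>V. f v = c}) ` (f ` V) = P" by simp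
      moreover have "f \<in> V \<rightarrow>\<^sub>E K" unfolding f using g blk_in by auto
      ultimately show "f \<in> ?B" by simp
    next
      fix f assume "f \<in> ?B"
      then have fE: "f \<in> V \<rightarrow>\<^sub>E K" and fP: "(\<lambda>c. {v\<in>V. f v = c}) ` (f ` V) = P" by auto
      define g where "g = (\<lambda>B\<in>P. f (SOME v. v \<in> B))"
      have gB: "g B = f v" if B: "B \<in> P" and v: "v \<in> B" for B v
      proof -
        obtain c where c: "B = {v\<in>V. f v = c}" using B fP by blast
        have "(SOME v. v \<in> B) \<in> B" using v by (rule someI)
        then have "f (SOME v. v \<in> B) = c" using c by simp
        moreover have "f v = c" using v c by simp
        ultimately show ?thesis using B by (simp add: g_def)
      qed
      have gF: "?F g = f"
      proof
        fix v show "?F g v = f v"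
          using gB blk_in[of v] fE by (cases "v \<in> V") auto
      qed
      have "inj_on g P"
      proof (rule inj_onI)
        fix B B' assume B: "B \<in> P" and B': "B' \<in> P" and e: "g B = g B'"
        obtain v where v: "v \<in> B" using ne B by blast
        obtain w where w: "w \<in> B'" using ne B' by blast
        obtain c where c: "B = {v\<in>V. f v = c}" using B fP by blast
        obtain c' where c': "B' = {v\<in>V. f v = c'}" using B' fP by blast
        have "f v = f w" using gB[OF B v] gB[OF B' w] e by simp
        then show "B = B'" using c c' v w by auto
      qed
      moreover have "g \<in> P \<rightarrow>\<^sub>E K"
      proof (rule PiE_I)
        fix B assume B: "B \<in> P"
        obtain v where v: "v \<in> B" using ne B by blast
        show "g B \<in> K" using gB[OF B v] fE sub[OF B] v by auto
      qed (simp add: g_def)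
      ultimately show "f \<in> ?F ` ?A" using gF by (intro image_eqI[of _ _ g]) auto
    qed
  qed
  then show ?thesis
    using card_inj_on_subset_funcset[OF finP K order_refl] by (auto dest: bij_betw_same_card)
qed

lemma card_colorings_polynomial:
  fixes G :: "'a pair_pre_digraph"
  assumes V: "finite (pverts G)"
  shows "\<exists>p::int poly. \<forall>k::nat. poly p (int k) = int (card (colorings \<C> G k))"
proof -
  let ?V = "pverts G"
  define \<P> where "\<P> = {P. partition_on ?V P \<and> (\<forall>B\<in>P. pair_induce G B \<in> \<C>)}"
  have fin: "finite \<P>"
    by (rule finite_subset[OF _ finitely_many_partition_on[OF V]]) (auto simp: \<P>_def)
  define S where "S k P = {f \<in> ?V \<rightarrow>\<^sub>E {1..k}. (\<lambda>c. {v\<in>?V. f v = c}) ` (f ` ?V) = P}"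
    for k :: nat and P
  have col: "colorings \<C> G k = (\<Union>P\<in>\<P>. S k P)" for k
  proof (intro equalityI subsetI)
    fix f assume f: "f \<in> colorings \<C> G k"
    let ?P = "(\<lambda>c. {v\<in>?V. f v = c}) ` (f ` ?V)"
    have "partition_on ?V ?P"
      by (rule partition_onI) (auto simp: disjnt_def)
    moreover have "pair_induce G B \<in> \<C>" if B: "B \<in> ?P" for B
    proof -
      obtain w where w: "w \<in> ?V" "B = {v\<in>?V. f v = f w}" using B by blast
      moreover have "f w \<in> {1..k}" using f w by (auto simp: colorings_def)
      ultimately show ?thesis using f unfolding colorings_def by blast
    qed
    ultimately have "?P \<in> \<P>" by (auto simp: \<P>_def)
    moreover have "f \<in> S k ?P" using f by (auto simp: S_def colorings_def)
    ultimately show "f \<in> (\<Union>P\<in>\<P>. S k P)" by blast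
  next
    fix f assume "f \<in> (\<Union>P\<in>\<P>. S k P)"
    then obtain P where P: "P \<in> \<P>" and f: "f \<in> ?V \<rightarrow>\<^sub>E {1..k}"
      and fP: "(\<lambda>c. {v\<in>?V. f v = c}) ` (f ` ?V) = P" by (auto simp: S_def)
    have "pair_induce G {v\<in>?V. f v = c} \<in> \<C>" if "{v\<in>?V. f v = c} \<noteq> {}" for c
    proof -
      have "c \<in> f ` ?V" using that by blast
      then have "{v\<in>?V. f v = c} \<in> P" using fP by blast
      then show ?thesis using P by (auto simp: \<P>_def)
    qed
    then show "f \<in> colorings \<C> G k" using f unfolding colorings_def by blast
  qed
  have finS: "finite (S k P)" for k P
    by (rule finite_subset[OF _ finite_PiE[OF V, of "\<lambda>_. {1..k}"]]) (auto simp: S_def)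
  have card_S: "card (colorings \<C> G k) = (\<Sum>P\<in>\<P>. prod ((-) k) {0..<card P})" for k
  proof -
    have "card (colorings \<C> G k) = (\<Sum>P\<in>\<P>. card (S k P))"
      unfolding col by (rule card_UN_disjoint[OF fin]) (auto simp: finS, auto simp: S_def)
    also have "\<dots> = (\<Sum>P\<in>\<P>. prod ((-) k) {0..<card P})"
      by (rule sum.cong[OF refl])
        (use card_funcs_with_fibres[OF V finite_atLeastAtMost[of "Suc 0" k]] in
          \<open>simp add: S_def \<P>_def\<close>)
    finally show ?thesis .
  qed
  have ff: "int (prod ((-) k) {0..<m}) = (\<Prod>i=0..<m. int k - int i)" for k m :: nat
  proof (cases "k < m")
    case True
    then have "prod ((-) k) {0..<m} = 0" by (intro prod_zero) (auto intro!: bexI[of _ k])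
    moreover have "(\<Prod>i=0..<m. int k - int i) = 0"
      using True by (intro prod_zero) (auto intro!: bexI[of _ k])
    ultimately show ?thesis by (simp only: of_nat_0)
  next
    case False
    then show ?thesis by (simp add: of_nat_diff)
  qed
  let ?p = "\<Sum>P\<in>\<P>. \<Prod>i=0..<card P. [:- int i, 1:]"
  have "poly ?p (int k) = int (card (colorings \<C> G k))" for k
    unfolding card_S by (simp add: poly_sum poly_prod ff del: of_nat_prod)
  then show ?thesis by blast
qed

lemma poly_chi:
  fixes G :: "'a pair_pre_digraph"
  assumes "finite (pverts G)"
  shows "poly (chi \<C> G) (int k) = int (card (colorings \<C> G k))"
proof -
  have uniq: "p = q"
    if "\<forall>k::nat. poly p (int k) = poly q (int k)" for p q :: "int poly"
  proof (rule ccontr)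
    assume "p \<noteq> q"
    then have "finite {x. poly (p - q) x = 0}" by (intro poly_roots_finite) simp
    moreover have "range int \<subseteq> {x. poly (p - q) x = 0}" using that by auto
    ultimately have "finite (range int)" by (rule finite_subset[rotated])
    then show False using finite_imageD[of int UNIV] inj_of_nat infinite_UNIV_nat by blast
  qed
  obtain p :: "int poly" where p: "\<forall>k::nat. poly p (int k) = int (card (colorings \<C> G k))"
    using card_colorings_polynomial[OF assms] by blast
  have "chi \<C> G = p"
    unfolding chi_def by (rule the_equality[where P = "\<lambda>p. \<forall>k::nat. poly p (int k) = _ k", OF p])
      (use p in \<open>auto intro: uniq\<close>)
  then show ?thesis using p by simp
qed

end

theory Submission
  imports Defs
begin

text \<open>
  There is at most one colouring with a single colour, so \<open>\<chi>\<^sub>\<C>(G; 1) \<le> 1\<close>, whereas \<open>DOM(G; 1)\<close>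
  counts all dominating sets of \<open>G\<close>. The complete graph on two vertices has more than one.
\<close>

lemma poly_DOM_1: "poly (DOM G) 1 = int (card {A. dominating_set G A})"
  by (simp add: DOM_def poly_sum poly_monom)

lemma card_colorings_1_le: "card (colorings \<C> G 1) \<le> 1"
proof -
  \<comment> \<open>Vertices only have the colour 1 available, and
    \<open>\<rightarrow>\<^sub>E\<close> forces \<open>undefined\<close> off
    \<open>pverts G\<close>, so no second function is possible.\<close>
  have "colorings \<C> G 1 \<subseteq> {\<lambda>v\<in>pverts G. 1}"
    by (auto simp: colorings_def intro!: extensionalityI[of _ "pverts G"])
  then show ?thesis
    using card_mono[of "{\<lambda>v\<in>pverts G. 1::nat}"] by simp
qed

text \<open>Compare both polynomials at 1. Finiteness enables \<open>poly_chi\<close>, which turns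
  the value of \<open>chi\<close> there into a number of colourings.\<close>

lemma card_dominating_sets_le_1:
  assumes "finite (pverts G)" and "DOM G = chi \<C> G"
  shows "card {A. dominating_set G A} \<le> 1"
  using poly_DOM_1[of G] poly_chi[OF assms(1), of \<C> 1] card_colorings_1_le[of \<C> G] assms(2)
  by simp

text \<open>Having no loops, this graph lies in both classes of the theorem, so it refutes both
  variants at once.\<close>

definition K2 :: "nat pair_pre_digraph" where
  "K2 = \<lparr>pverts = {0, 1}, parcs = {(0, 1), (1, 0)}\<rparr>"

lemma pair_graph_K2: "pair_graph K2"
proof unfold_locales
  show "symmetric K2"
    unfolding symmetric_def by (rule symI) (auto simp: K2_def)
qed (auto simp: K2_def)

lemma DOM_K2_neq_chi: "DOM K2 \<noteq> chi \<C> K2"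
proof
  assume "DOM K2 = chi \<C> K2"
  then have "card {A. dominating_set K2 A} \<le> 1"
    by (intro card_dominating_sets_le_1) (simp_all add: K2_def)
  \<comment> \<open>Either endpoint of the edge dominates the other, which gives two distinct
    dominating sets.\<close>
  moreover have "card {{0}, {1::nat}} \<le> card {A. dominating_set K2 A}"
  proof (rule card_mono)
    show "finite {A. dominating_set K2 A}"
      by (rule finite_subset[of _ "Pow {0, 1}"]) (auto simp: dominating_set_def K2_def)
    show "{{0}, {1}} \<subseteq> {A. dominating_set K2 A}"
      by (auto simp: dominating_set_def K2_def)
  qed
  ultimately show False by simp
qed

theorem theorem16:
  shows
        "\<not> (\<exists>\<C> :: nat pair_pre_digraph set. graph_property pair_pseudo_graph \<C> \<and>
             (\<forall>G. pair_pseudo_graph G \<longrightarrow> DOM G = chi \<C> G)) \<and>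
         \<not> (\<exists>\<C> :: nat pair_pre_digraph set. graph_property pair_graph \<C> \<and>
             (\<forall>G. pair_graph G \<longrightarrow> DOM G = chi \<C> G))"
  using pair_graph_K2 pair_graph.axioms(2)[OF pair_graph_K2] DOM_K2_neq_chi by blast

end
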